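(* Let $G$ be a finite group and let $H$ be a normal subgroup of $G$. Then there exists a finite incidence geometry $\Gamma$ such that the pairs $(\operatorname{Aut}(\Gamma),\operatorname{Aut}_I(\Gamma))$ and $(G,H)$ are isomorphic, i.e. there is a group isomorphism $\varphi\colon \operatorname{Aut}(\Gamma)\to G$ with $\varphi(\operatorname{Aut}_I(\Gamma))=H$.
   Context: An incidence system is a tuple $\Gamma=(X,\ast,t,I)$ where $X$ is a non-empty set (of elements), $I$ is a finite set (of types), $t\colon X\to I$ is a surjective map (the type function), and $\ast$ is a symmetric binary relation on $X$ (the incidence relation) such that for all $x,y\in X$, if $x\neq y$ and $x\ast y$, then $t(x)\neq t(y)$. By convention, an element is not incident to itself. $\Gamma$ is finite if $X$ is finite. A flag of $\Gamma$ is a subset $F\subset X$ such that $x\ast y$ for all $x,y\in F$ with $x\neq y$; its rank is $|F|$. A chamber is a flag of rank $|I|$. An incidence geometry is an incidence system in which every flag is contained in a chamber. A correlation of $\Gamma$ is a permutation $f$ of $X$ such that for all $x,y\in X$: $x\ast y\Leftrightarrow f(x)\ast f(y)$, and $t(x)=t(y)\Leftrightarrow t(f(x))=t(f(y))$. An automorphism of $\Gamma$ is a correlation $f$ with $t(f(x))=t(x)$ for all $x\in X$. $\operatorname{Aut}(\Gamma)$ denotes the group of all correlations of $\Gamma$ under composition, and $\operatorname{Aut}_I(\Gamma)$ denotes its normal subgroup consisting of the automorphisms of $\Gamma$. *)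

theory Defs
  imports "HOL-Algebra.Bij" "HOL-Algebra.Coset"
begin

text \<open>Only the values of \<open>typ_of\<close> on \<open>elements\<close> are meaningful.\<close>

record ('a, 'i) incidence_structure =
  elements :: "'a set"
  types :: "'i set"
  typ_of :: "'a \<Rightarrow> 'i"
  inc :: "('a \<times> 'a) set"

text \<open>The relation \<open>inc\<close> is irreflexive, following the convention that an element is not
  incident to itself.\<close>

locale incidence_system =
  fixes \<Gamma> :: "('a, 'i, 'm) incidence_structure_scheme"
  assumes elements_nonempty: "elements \<Gamma> \<noteq> {}"
    and finite_types: "finite (types \<Gamma>)"
    and typ_surj: "typ_of \<Gamma> ` elements \<Gamma> = types \<Gamma>"
    and inc_subset: "inc \<Gamma> \<subseteq> elements \<Gamma> \<times> elements \<Gamma>"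
    and inc_sym: "sym (inc \<Gamma>)"
    and inc_irrefl: "irrefl (inc \<Gamma>)"
    and inc_typ: "\<lbrakk>x \<in> elements \<Gamma>; y \<in> elements \<Gamma>; x \<noteq> y; (x, y) \<in> inc \<Gamma>\<rbrakk>
      \<Longrightarrow> typ_of \<Gamma> x \<noteq> typ_of \<Gamma> y"

definition flag :: "('a, 'i, 'm) incidence_structure_scheme \<Rightarrow> 'a set \<Rightarrow> bool" where
  "flag \<Gamma> F \<longleftrightarrow> F \<subseteq> elements \<Gamma> \<and> (\<forall>x\<in>F. \<forall>y\<in>F. x \<noteq> y \<longrightarrow> (x, y) \<in> inc \<Gamma>)"

text \<open>In an incidence system every flag is finite, since \<open>typ_of\<close> is injective on it
  and \<open>types\<close> is finite; so \<open>card\<close> is the rank.\<close>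

definition chamber :: "('a, 'i, 'm) incidence_structure_scheme \<Rightarrow> 'a set \<Rightarrow> bool" where
  "chamber \<Gamma> C \<longleftrightarrow> flag \<Gamma> C \<and> card C = card (types \<Gamma>)"

locale incidence_geometry = incidence_system +
  assumes flag_in_chamber: "flag \<Gamma> F \<Longrightarrow> \<exists>C. chamber \<Gamma> C \<and> F \<subseteq> C"

text \<open>As in \<^term>\<open>BijGroup\<close>, permutations of \<open>elements\<close> are extensional functions, so that
  distinct members of \<^term>\<open>Bij S\<close> are distinct permutations of \<open>S\<close>.\<close>

definition correlations :: "('a, 'i, 'm) incidence_structure_scheme \<Rightarrow> ('a \<Rightarrow> 'a) set" where
  "correlations \<Gamma> = {f \<in> Bij (elements \<Gamma>). \<forall>x\<in>elements \<Gamma>. \<forall>y\<in>elements \<Gamma>.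
     ((x, y) \<in> inc \<Gamma> \<longleftrightarrow> (f x, f y) \<in> inc \<Gamma>) \<and>
     (typ_of \<Gamma> x = typ_of \<Gamma> y \<longleftrightarrow> typ_of \<Gamma> (f x) = typ_of \<Gamma> (f y))}"

definition automorphisms :: "('a, 'i, 'm) incidence_structure_scheme \<Rightarrow> ('a \<Rightarrow> 'a) set" where
  "automorphisms \<Gamma> = {f \<in> correlations \<Gamma>. \<forall>x\<in>elements \<Gamma>. typ_of \<Gamma> (f x) = typ_of \<Gamma> x}"

definition Aut :: "('a, 'i, 'm) incidence_structure_scheme \<Rightarrow> ('a \<Rightarrow> 'a) monoid" where
  "Aut \<Gamma> = BijGroup (elements \<Gamma>)\<lparr>carrier := correlations \<Gamma>\<rparr>"

lemma subgroup_correlations: "subgroup (correlations \<Gamma>) (BijGroup (elements \<Gamma>))"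
proof -
  let ?X = "elements \<Gamma>"
  interpret B: group "BijGroup ?X" by (rule group_BijGroup)
  show ?thesis
  proof (rule B.subgroupI)
    show "correlations \<Gamma> \<subseteq> carrier (BijGroup ?X)"
      by (auto simp: correlations_def BijGroup_def)
    have "(\<lambda>x\<in>?X. x) \<in> correlations \<Gamma>"
      by (auto simp: correlations_def id_Bij)
    then show "correlations \<Gamma> \<noteq> {}" by blast
  next
    fix f assume f: "f \<in> correlations \<Gamma>"
    let ?g = "\<lambda>x\<in>?X. inv_into ?X f x"
    have fB: "f \<in> Bij ?X" using f by (simp add: correlations_def)
    then have im: "f ` ?X = ?X" by (simp add: Bij_def bij_betw_def)
    have g: "?g x \<in> ?X" "f (?g x) = x" if "x \<in> ?X" for x
      using that im by (auto simp: inv_into_into f_inv_into_f)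
    have cor: "((x, y) \<in> inc \<Gamma> \<longleftrightarrow> (f x, f y) \<in> inc \<Gamma>) \<and>
       (typ_of \<Gamma> x = typ_of \<Gamma> y \<longleftrightarrow> typ_of \<Gamma> (f x) = typ_of \<Gamma> (f y))" if "x \<in> ?X" "y \<in> ?X" for x y
      using f that by (simp add: correlations_def)
    have "?g \<in> correlations \<Gamma>"
      unfolding correlations_def
    proof (intro CollectI conjI[OF restrict_inv_into_Bij[OF fB]] ballI)
      fix x y assume "x \<in> ?X" "y \<in> ?X"
      then show "((x, y) \<in> inc \<Gamma> \<longleftrightarrow> (?g x, ?g y) \<in> inc \<Gamma>) \<and>
         (typ_of \<Gamma> x = typ_of \<Gamma> y \<longleftrightarrow> typ_of \<Gamma> (?g x) = typ_of \<Gamma> (?g y))"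
        using cor[of "?g x" "?g y"] g[of x] g[of y] by metis
    qed
    then show "inv\<^bsub>BijGroup ?X\<^esub> f \<in> correlations \<Gamma>" by (simp add: inv_BijGroup[OF fB])
  next
    fix f g assume fg: "f \<in> correlations \<Gamma>" "g \<in> correlations \<Gamma>"
    then have B: "f \<in> Bij ?X" "g \<in> Bij ?X" by (simp_all add: correlations_def)
    then have "g x \<in> ?X" if "x \<in> ?X" for x
      using that by (auto simp: Bij_def bij_betw_def)
    then have "compose ?X f g \<in> correlations \<Gamma>"
      using fg compose_Bij[OF B] by (auto simp: correlations_def compose_eq)
    then show "f \<otimes>\<^bsub>BijGroup ?X\<^esub> g \<in> correlations \<Gamma>" using B by (simp add: BijGroup_def)
  qed
qed

lemma group_Aut: "group (Aut \<Gamma>)"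
  unfolding Aut_def
  by (rule subgroup.subgroup_is_group[OF subgroup_correlations group_BijGroup])

lemma normal_automorphisms: "automorphisms \<Gamma> \<lhd> Aut \<Gamma>"
proof -
  let ?X = "elements \<Gamma>"
  interpret A: group "Aut \<Gamma>" by (rule group_Aut)
  have carr: "carrier (Aut \<Gamma>) = correlations \<Gamma>" by (simp add: Aut_def)
  have corB: "f \<in> Bij ?X" if "f \<in> correlations \<Gamma>" for f
    using that by (simp add: correlations_def)
  have mapsto: "f x \<in> ?X" if "f \<in> correlations \<Gamma>" "x \<in> ?X" for f x
    using corB[OF that(1)] that(2) by (auto simp: Bij_def bij_betw_def)
  have mult: "(f \<otimes>\<^bsub>Aut \<Gamma>\<^esub> g) x = f (g x)"
    if "f \<in> correlations \<Gamma>" "g \<in> correlations \<Gamma>" "x \<in> ?X" for f g x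
    using that by (simp add: Aut_def BijGroup_def corB compose_eq)
  have one: "\<one>\<^bsub>Aut \<Gamma>\<^esub> x = x" if "x \<in> ?X" for x
    using that by (simp add: Aut_def BijGroup_def)
  have inv_cor: "inv\<^bsub>Aut \<Gamma>\<^esub> f \<in> correlations \<Gamma>" if "f \<in> correlations \<Gamma>" for f
    using A.inv_closed that by (simp add: carr)
  have f_inv: "f ((inv\<^bsub>Aut \<Gamma>\<^esub> f) x) = x" if "f \<in> correlations \<Gamma>" "x \<in> ?X" for f x
    using that mult[OF that(1) inv_cor[OF that(1)] that(2)] A.r_inv[of f] one[OF that(2)]
    by (simp add: carr)
  have typ_cong: "typ_of \<Gamma> (f x) = typ_of \<Gamma> (f y)"
    if "f \<in> correlations \<Gamma>" "x \<in> ?X" "y \<in> ?X" "typ_of \<Gamma> x = typ_of \<Gamma> y" for f x y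
    using that by (simp add: correlations_def)
  have sub: "automorphisms \<Gamma> \<subseteq> correlations \<Gamma>" by (auto simp: automorphisms_def)
  have typ_aut: "typ_of \<Gamma> (f x) = typ_of \<Gamma> x" if "f \<in> automorphisms \<Gamma>" "x \<in> ?X" for f x
    using that by (simp add: automorphisms_def)
  have "subgroup (automorphisms \<Gamma>) (Aut \<Gamma>)"
  proof (rule A.subgroupI)
    show "automorphisms \<Gamma> \<subseteq> carrier (Aut \<Gamma>)" using sub by (simp add: carr)
    have "\<one>\<^bsub>Aut \<Gamma>\<^esub> \<in> automorphisms \<Gamma>"
      using A.one_closed one by (simp add: carr automorphisms_def)
    then show "automorphisms \<Gamma> \<noteq> {}" by blast
  next
    fix f assume f: "f \<in> automorphisms \<Gamma>"
    then have fc: "f \<in> correlations \<Gamma>" using sub by blast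
    have "typ_of \<Gamma> ((inv\<^bsub>Aut \<Gamma>\<^esub> f) x) = typ_of \<Gamma> x" if "x \<in> ?X" for x
      using typ_aut[OF f mapsto[OF inv_cor[OF fc] that]] f_inv[OF fc that] by simp
    then show "inv\<^bsub>Aut \<Gamma>\<^esub> f \<in> automorphisms \<Gamma>"
      using inv_cor[OF fc] by (simp add: automorphisms_def)
  next
    fix f g assume fg: "f \<in> automorphisms \<Gamma>" "g \<in> automorphisms \<Gamma>"
    then have c: "f \<in> correlations \<Gamma>" "g \<in> correlations \<Gamma>" using sub by blast+
    have "f \<otimes>\<^bsub>Aut \<Gamma>\<^esub> g \<in> correlations \<Gamma>" using A.m_closed c by (simp add: carr)
    then show "f \<otimes>\<^bsub>Aut \<Gamma>\<^esub> g \<in> automorphisms \<Gamma>"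
      using fg c by (simp add: automorphisms_def mult mapsto)
  qed
  moreover have "f \<otimes>\<^bsub>Aut \<Gamma>\<^esub> h \<otimes>\<^bsub>Aut \<Gamma>\<^esub> inv\<^bsub>Aut \<Gamma>\<^esub> f \<in> automorphisms \<Gamma>"
    if f: "f \<in> carrier (Aut \<Gamma>)" and h: "h \<in> automorphisms \<Gamma>" for f h
  proof -
    have c: "f \<in> correlations \<Gamma>" "h \<in> correlations \<Gamma>" using f h sub carr by auto
    note ic = inv_cor[OF c(1)]
    have fh: "f \<otimes>\<^bsub>Aut \<Gamma>\<^esub> h \<in> correlations \<Gamma>" using A.m_closed c by (simp add: carr)
    have "f \<otimes>\<^bsub>Aut \<Gamma>\<^esub> h \<otimes>\<^bsub>Aut \<Gamma>\<^esub> inv\<^bsub>Aut \<Gamma>\<^esub> f \<in> correlations \<Gamma>"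
      using A.m_closed fh ic by (simp add: carr)
    moreover have "typ_of \<Gamma> ((f \<otimes>\<^bsub>Aut \<Gamma>\<^esub> h \<otimes>\<^bsub>Aut \<Gamma>\<^esub> inv\<^bsub>Aut \<Gamma>\<^esub> f) x) = typ_of \<Gamma> x"
      if x: "x \<in> ?X" for x
    proof -
      let ?y = "(inv\<^bsub>Aut \<Gamma>\<^esub> f) x"
      have y: "?y \<in> ?X" using mapsto[OF ic x] .
      have "(f \<otimes>\<^bsub>Aut \<Gamma>\<^esub> h \<otimes>\<^bsub>Aut \<Gamma>\<^esub> inv\<^bsub>Aut \<Gamma>\<^esub> f) x = f (h ?y)"
        by (simp only: mult[OF fh ic x] mult[OF c y])
      then show ?thesis
        using typ_cong[OF c(1) mapsto[OF c(2) y] y typ_aut[OF h y]] f_inv[OF c(1) x] by simp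
    qed
    ultimately show ?thesis by (simp add: automorphisms_def)
  qed
  ultimately show ?thesis using A.normal_inv_iff by blast
qed

end

theory Submission
  imports Defs
begin

text \<open>
  Giving every type a universal element, incident to all elements of other types, makes every flag
  extend to a chamber, so only a multipartite graph with the right symmetries is needed.
  Number \<open>G\<close> by \<open>c : G \<rightarrow> {0, ..., n - 1}\<close>. The graph has points \<open>Pt h\<close> and, on levels
  \<open>j = 0, ..., n\<close>, elements \<open>Lev j g\<close>, with \<open>Lev j g\<close> incident to \<open>Pt h\<close> iff \<open>c (g\<^sup>-\<^sup>1 h) < j\<close>
  and to \<open>Lev i g\<close> for \<open>i \<noteq> j\<close>. A correlation preserves the level, because \<open>Lev j g\<close> is incident
  to exactly \<open>j\<close> points; acting equally on all levels, it then preserves every \<open>c (g\<^sup>-\<^sup>1 h)\<close>, hence is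
  a left translation. The type of \<open>Lev j g\<close> is \<open>(j, gH)\<close>, so the translations that fix all types
  are those by elements of \<open>H\<close>.
\<close>

section \<open>Transport of correlations along bijections that preserve incidence and equality of
  types\<close>

definition incidence_equiv ::
  "('a \<Rightarrow> 'b) \<Rightarrow> ('a, 'i) incidence_structure \<Rightarrow> ('b, 'j) incidence_structure \<Rightarrow> bool" where
  "incidence_equiv f \<Gamma> \<Delta> \<longleftrightarrow> bij_betw f (elements \<Gamma>) (elements \<Delta>) \<and>
    (\<forall>x\<in>elements \<Gamma>. \<forall>y\<in>elements \<Gamma>.
      ((x, y) \<in> inc \<Gamma> \<longleftrightarrow> (f x, f y) \<in> inc \<Delta>) \<and>
      (typ_of \<Gamma> x = typ_of \<Gamma> y \<longleftrightarrow> typ_of \<Delta> (f x) = typ_of \<Delta> (f y)))"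

lemma incidence_equiv_inv_into:
  assumes "incidence_equiv f \<Gamma> \<Delta>"
  shows "incidence_equiv (inv_into (elements \<Gamma>) f) \<Delta> \<Gamma>"
proof -
  let ?g = "inv_into (elements \<Gamma>) f"
  have bij: "bij_betw f (elements \<Gamma>) (elements \<Delta>)"
    using assms by (simp add: incidence_equiv_def)
  have g: "?g x \<in> elements \<Gamma>" "f (?g x) = x" if "x \<in> elements \<Delta>" for x
    using that bij by (auto simp: bij_betw_def inv_into_into f_inv_into_f)
  have f: "((x, y) \<in> inc \<Gamma> \<longleftrightarrow> (f x, f y) \<in> inc \<Delta>) \<and>
      (typ_of \<Gamma> x = typ_of \<Gamma> y \<longleftrightarrow> typ_of \<Delta> (f x) = typ_of \<Delta> (f y))"
    if "x \<in> elements \<Gamma>" "y \<in> elements \<Gamma>" for x y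
    using assms that by (simp add: incidence_equiv_def)
  show ?thesis
    unfolding incidence_equiv_def
    using bij_betw_inv_into[OF bij] f g by simp
qed

text \<open>Conjugation of \<open>\<phi>\<close> by \<open>f\<close>, made extensional on the target
  as membership in \<open>Bij\<close> demands.\<close>

definition conj_map ::
  "('a \<Rightarrow> 'b) \<Rightarrow> ('a, 'i) incidence_structure \<Rightarrow> ('b, 'j) incidence_structure \<Rightarrow>
    ('a \<Rightarrow> 'a) \<Rightarrow> 'b \<Rightarrow> 'b" where
  "conj_map f \<Gamma> \<Delta> \<phi> = (\<lambda>y\<in>elements \<Delta>. f (\<phi> (inv_into (elements \<Gamma>) f y)))"

lemma correlations_closed:
  "\<phi> \<in> correlations \<Gamma> \<Longrightarrow> x \<in> elements \<Gamma> \<Longrightarrow> \<phi> x \<in> elements \<Gamma>"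
  by (auto simp: correlations_def Bij_def bij_betw_def)

lemma conj_map_apply:
  assumes "incidence_equiv f \<Gamma> \<Delta>" "x \<in> elements \<Gamma>"
  shows "conj_map f \<Gamma> \<Delta> \<phi> (f x) = f (\<phi> x)"
  using assms by (auto simp: conj_map_def incidence_equiv_def bij_betw_def)

lemma conj_map_correlations:
  assumes f: "incidence_equiv f \<Gamma> \<Delta>" and \<phi>: "\<phi> \<in> correlations \<Gamma>"
  shows "conj_map f \<Gamma> \<Delta> \<phi> \<in> correlations \<Delta>"
proof -
  let ?X = "elements \<Gamma>" and ?Y = "elements \<Delta>" and ?g = "inv_into (elements \<Gamma>) f"
  have bij: "bij_betw f ?X ?Y" using f by (simp add: incidence_equiv_def)
  have Y: "?Y = f ` ?X" using bij by (simp add: bij_betw_def)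
  have "bij_betw \<phi> ?X ?X" using \<phi> by (simp add: correlations_def Bij_def)
  then have "bij_betw (f \<circ> (\<phi> \<circ> ?g)) ?Y ?Y"
    using bij bij_betw_inv_into[OF bij] by (blast intro: bij_betw_trans)
  then have "bij_betw (conj_map f \<Gamma> \<Delta> \<phi>) ?Y ?Y"
    by (rule bij_betw_cong[THEN iffD1, rotated]) (simp add: conj_map_def)
  moreover have "conj_map f \<Gamma> \<Delta> \<phi> \<in> extensional ?Y" by (simp add: conj_map_def)
  moreover have "((f x, f y) \<in> inc \<Delta> \<longleftrightarrow> (f (\<phi> x), f (\<phi> y)) \<in> inc \<Delta>) \<and>
     (typ_of \<Delta> (f x) = typ_of \<Delta> (f y) \<longleftrightarrow> typ_of \<Delta> (f (\<phi> x)) = typ_of \<Delta> (f (\<phi> y)))"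
    if "x \<in> ?X" "y \<in> ?X" for x y
    using that f \<phi> correlations_closed[OF \<phi>]
    by (simp add: incidence_equiv_def correlations_def)
  ultimately show ?thesis
    by (simp add: correlations_def Bij_def Y conj_map_apply[OF f])
qed

text \<open>Fixing the type of \<open>x\<close> is the equality of the types of
  \<open>\<phi> x\<close> and \<open>x\<close>. The map \<open>f\<close> preserves and reflects such
  equalities, although it may relabel the types themselves.\<close>

lemma conj_map_automorphisms_iff:
  assumes f: "incidence_equiv f \<Gamma> \<Delta>" and \<phi>: "\<phi> \<in> correlations \<Gamma>"
  shows "conj_map f \<Gamma> \<Delta> \<phi> \<in> automorphisms \<Delta> \<longleftrightarrow> \<phi> \<in> automorphisms \<Gamma>"
proof -
  have Y: "elements \<Delta> = f ` elements \<Gamma>"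
    using f by (simp add: incidence_equiv_def bij_betw_def)
  have "typ_of \<Delta> (f (\<phi> x)) = typ_of \<Delta> (f x) \<longleftrightarrow> typ_of \<Gamma> (\<phi> x) = typ_of \<Gamma> x"
    if "x \<in> elements \<Gamma>" for x
    using that f correlations_closed[OF \<phi> that] by (simp add: incidence_equiv_def)
  then show ?thesis
    using conj_map_correlations[OF f \<phi>] \<phi>
    by (auto simp: automorphisms_def Y conj_map_apply[OF f])
qed

lemma mult_Aut:
  assumes "\<phi> \<in> correlations \<Gamma>" "\<psi> \<in> correlations \<Gamma>"
  shows "\<phi> \<otimes>\<^bsub>Aut \<Gamma>\<^esub> \<psi> = compose (elements \<Gamma>) \<phi> \<psi>"
  using assms by (simp add: Aut_def BijGroup_def correlations_def)

lemma correlations_eqI: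
  assumes "\<phi> \<in> correlations \<Gamma>" "\<psi> \<in> correlations \<Gamma>" "\<And>x. x \<in> elements \<Gamma> \<Longrightarrow> \<phi> x = \<psi> x"
  shows "\<phi> = \<psi>"
  using assms by (auto simp: correlations_def Bij_def intro: extensionalityI)

text \<open>Supplies preimages under conjugation by \<open>f\<close>, hence its
  surjectivity.\<close>

lemma conj_map_conj_map_inv:
  assumes f: "incidence_equiv f \<Gamma> \<Delta>" and \<psi>: "\<psi> \<in> correlations \<Delta>"
  shows "conj_map f \<Gamma> \<Delta> (conj_map (inv_into (elements \<Gamma>) f) \<Delta> \<Gamma> \<psi>) = \<psi>"
proof (rule correlations_eqI[OF _ \<psi>])
  let ?g = "inv_into (elements \<Gamma>) f"
  note g = incidence_equiv_inv_into[OF f]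
  show "conj_map f \<Gamma> \<Delta> (conj_map ?g \<Delta> \<Gamma> \<psi>) \<in> correlations \<Delta>"
    by (rule conj_map_correlations[OF f conj_map_correlations[OF g \<psi>]])
  fix y assume y: "y \<in> elements \<Delta>"
  have bij: "bij_betw f (elements \<Gamma>) (elements \<Delta>)" using f by (simp add: incidence_equiv_def)
  have "f (?g z) = z" if "z \<in> elements \<Delta>" for z
    using that bij by (simp add: bij_betw_def f_inv_into_f)
  then show "conj_map f \<Gamma> \<Delta> (conj_map ?g \<Delta> \<Gamma> \<psi>) y = \<psi> y"
    using y conj_map_apply[OF g y] correlations_closed[OF \<psi> y] by (simp add: conj_map_def[of f])
qed

lemma conj_map_iso:
  assumes f: "incidence_equiv f \<Gamma> \<Delta>"
  shows "conj_map f \<Gamma> \<Delta> \<in> iso (Aut \<Gamma>) (Aut \<Delta>)"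
    and "conj_map f \<Gamma> \<Delta> ` automorphisms \<Gamma> = automorphisms \<Delta>"
proof -
  let ?T = "conj_map f \<Gamma> \<Delta>" and ?S = "conj_map (inv_into (elements \<Gamma>) f) \<Delta> \<Gamma>"
  have bij: "bij_betw f (elements \<Gamma>) (elements \<Delta>)" using f by (simp add: incidence_equiv_def)
  have carr [simp]: "carrier (Aut \<Gamma>) = correlations \<Gamma>" "carrier (Aut \<Delta>) = correlations \<Delta>"
    by (simp_all add: Aut_def)
  note T = conj_map_correlations[OF f]
  have S: "?S \<psi> \<in> correlations \<Gamma>" "?T (?S \<psi>) = \<psi>" if "\<psi> \<in> correlations \<Delta>" for \<psi>
    using that conj_map_correlations[OF incidence_equiv_inv_into[OF f]]
      conj_map_conj_map_inv[OF f] by auto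
  have "?T (\<phi> \<otimes>\<^bsub>Aut \<Gamma>\<^esub> \<psi>) = ?T \<phi> \<otimes>\<^bsub>Aut \<Delta>\<^esub> ?T \<psi>"
    if \<phi>: "\<phi> \<in> correlations \<Gamma>" and \<psi>: "\<psi> \<in> correlations \<Gamma>" for \<phi> \<psi>
  proof (rule correlations_eqI)
    interpret \<Gamma>: group "Aut \<Gamma>" by (rule group_Aut)
    interpret \<Delta>: group "Aut \<Delta>" by (rule group_Aut)
    show "?T (\<phi> \<otimes>\<^bsub>Aut \<Gamma>\<^esub> \<psi>) \<in> correlations \<Delta>"
      using T \<Gamma>.m_closed[of \<phi> \<psi>] \<phi> \<psi> by simp
    show "?T \<phi> \<otimes>\<^bsub>Aut \<Delta>\<^esub> ?T \<psi> \<in> correlations \<Delta>"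
      using \<Delta>.m_closed[of "?T \<phi>" "?T \<psi>"] T \<phi> \<psi> by simp
    fix y assume "y \<in> elements \<Delta>"
    then obtain x where x: "x \<in> elements \<Gamma>" "y = f x" using bij by (auto simp: bij_betw_def)
    have "f x \<in> elements \<Delta>" using x bij by (auto simp: bij_betw_def)
    then show "?T (\<phi> \<otimes>\<^bsub>Aut \<Gamma>\<^esub> \<psi>) y = (?T \<phi> \<otimes>\<^bsub>Aut \<Delta>\<^esub> ?T \<psi>) y"
      using x correlations_closed[OF \<psi>]
      by (simp add: mult_Aut \<phi> \<psi> T conj_map_apply[OF f] compose_eq)
  qed
  moreover have "inj_on ?T (correlations \<Gamma>)"
  proof (rule inj_onI)
    fix \<phi> \<psi> assume *: "\<phi> \<in> correlations \<Gamma>" "\<psi> \<in> correlations \<Gamma>" "?T \<phi> = ?T \<psi>"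
    show "\<phi> = \<psi>"
    proof (rule correlations_eqI[OF *(1,2)])
      fix x assume x: "x \<in> elements \<Gamma>"
      then have "f (\<phi> x) = f (\<psi> x)"
        using *(3) conj_map_apply[OF f x, of \<phi>] conj_map_apply[OF f x, of \<psi>] by simp
      then show "\<phi> x = \<psi> x"
        using bij correlations_closed * x by (metis bij_betw_def inj_onD)
    qed
  qed
  moreover have "?T ` correlations \<Gamma> = correlations \<Delta>"
    using T S by (metis image_eqI image_subsetI subsetI subset_antisym)
  ultimately show "?T \<in> iso (Aut \<Gamma>) (Aut \<Delta>)"
    using T by (simp add: iso_iff hom_def)
  show "?T ` automorphisms \<Gamma> = automorphisms \<Delta>"
  proof
    show "?T ` automorphisms \<Gamma> \<subseteq> automorphisms \<Delta>"
      using conj_map_automorphisms_iff[OF f] by (auto simp: automorphisms_def)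
    show "automorphisms \<Delta> \<subseteq> ?T ` automorphisms \<Gamma>"
    proof
      fix \<psi> assume \<psi>: "\<psi> \<in> automorphisms \<Delta>"
      then have "\<psi> \<in> correlations \<Delta>" by (simp add: automorphisms_def)
      with S[OF this] \<psi> show "\<psi> \<in> ?T ` automorphisms \<Gamma>"
        using conj_map_automorphisms_iff[OF f, of "?S \<psi>"] by (metis image_eqI)
    qed
  qed
qed

text \<open>The group may have any element type, while the geometry sought lives over
  \<open>nat\<close>. Elements and types form finite sets, so both can be numbered injectively and
  the structure carried over.\<close>

lemma incidence_geometry_nat_copy:
  fixes \<Gamma> :: "('a, 'i) incidence_structure"
  assumes "incidence_geometry \<Gamma>" and fin: "finite (elements \<Gamma>)"
  obtains \<Delta> :: "(nat, nat) incidence_structure" and f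
    where "incidence_geometry \<Delta>" "finite (elements \<Delta>)" "incidence_equiv f \<Gamma> \<Delta>"
proof -
  interpret incidence_geometry \<Gamma> by fact
  let ?X = "elements \<Gamma>"
  obtain f :: "'a \<Rightarrow> nat" where f: "inj_on f ?X"
    using finite_imp_inj_to_nat_seg[OF fin] by blast
  obtain h :: "'i \<Rightarrow> nat" where h: "inj_on h (types \<Gamma>)"
    using finite_imp_inj_to_nat_seg[OF finite_types] by blast
  define \<Delta> where "\<Delta> = \<lparr>elements = f ` ?X, types = h ` types \<Gamma>,
    typ_of = h \<circ> typ_of \<Gamma> \<circ> inv_into ?X f, inc = map_prod f f ` inc \<Gamma>\<rparr>"
  have sel: "elements \<Delta> = f ` ?X" "types \<Delta> = h ` types \<Gamma>" "inc \<Delta> = map_prod f f ` inc \<Gamma>"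
    by (simp_all add: \<Delta>_def)
  have typ_f: "typ_of \<Delta> (f x) = h (typ_of \<Gamma> x)" if "x \<in> ?X" for x
    using that f by (simp add: \<Delta>_def)
  have typ_eq: "typ_of \<Delta> (f x) = typ_of \<Delta> (f y) \<longleftrightarrow> typ_of \<Gamma> x = typ_of \<Gamma> y"
    if "x \<in> ?X" "y \<in> ?X" for x y
    proof -
    have "typ_of \<Gamma> x \<in> types \<Gamma>" "typ_of \<Gamma> y \<in> types \<Gamma>" using that typ_surj by auto
    then show ?thesis using that h by (simp add: typ_f inj_on_eq_iff)
  qed
  have inc_f: "(f x, f y) \<in> inc \<Delta> \<longleftrightarrow> (x, y) \<in> inc \<Gamma>" if "x \<in> ?X" "y \<in> ?X" for x y
  proof
    assume "(f x, f y) \<in> inc \<Delta>"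
    then obtain u v where uv: "(u, v) \<in> inc \<Gamma>" "f x = f u" "f y = f v" by (auto simp: sel)
    then have "u \<in> ?X" "v \<in> ?X" using inc_subset by auto
    then show "(x, y) \<in> inc \<Gamma>" using uv that f by (simp add: inj_on_eq_iff)
  qed (simp add: sel map_prod_imageI)
  have sub: "inc \<Delta> \<subseteq> elements \<Delta> \<times> elements \<Delta>" using inc_subset by (auto simp: sel)
  have "incidence_equiv f \<Gamma> \<Delta>"
    using f by (simp add: incidence_equiv_def typ_eq inc_f sel(1) bij_betw_def)
  moreover have "incidence_geometry \<Delta>"
  proof
    show "elements \<Delta> \<noteq> {}" "finite (types \<Delta>)"
      using elements_nonempty finite_types by (simp_all add: sel)
    have "typ_of \<Delta> ` f ` ?X = h ` typ_of \<Gamma> ` ?X"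
      unfolding image_image using typ_f by (rule image_cong[OF refl])
    then show "typ_of \<Delta> ` elements \<Delta> = types \<Delta>" by (simp add: sel typ_surj)
    show "inc \<Delta> \<subseteq> elements \<Delta> \<times> elements \<Delta>" by (rule sub)
    show "sym (inc \<Delta>)" using inc_sym by (auto simp: sel sym_def)
    show "irrefl (inc \<Delta>)"
    proof (rule irreflI)
      fix y show "(y, y) \<notin> inc \<Delta>"
        using sub inc_f inc_irrefl by (auto simp: sel(1) irrefl_def)
    qed
    show "typ_of \<Delta> x \<noteq> typ_of \<Delta> y"
      if "x \<in> elements \<Delta>" "y \<in> elements \<Delta>" "x \<noteq> y" "(x, y) \<in> inc \<Delta>" for x y
      using that inc_f typ_eq by (auto simp: sel(1) dest: inc_typ[rotated 3])
    fix F assume F: "flag \<Delta> F"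
    \<comment> \<open>The flag is pulled back along \<open>f\<close> and completed to a chamber of
      \<open>\<Gamma>\<close>; the image of that chamber contains \<open>F\<close>.\<close>
    define E where "E = inv_into ?X f ` F"
    have FX: "F \<subseteq> f ` ?X" using F by (simp add: flag_def sel)
    then have E: "E \<subseteq> ?X" "f ` E = F"
      by (auto simp: E_def inv_into_into image_inv_into_cancel[OF refl])
    have "f x \<noteq> f y" if "x \<in> E" "y \<in> E" "x \<noteq> y" for x y
      using that E(1) f by (meson inj_onD subsetD)
    then have "flag \<Gamma> E"
      using F E(1) inc_f unfolding flag_def E(2)[symmetric] by (auto simp: subset_iff)
    then obtain C where C: "chamber \<Gamma> C" "E \<subseteq> C" using flag_in_chamber by blast
    then have CX: "C \<subseteq> ?X" by (simp add: chamber_def flag_def)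
    have "flag \<Delta> (f ` C)"
      using C(1) CX inc_f by (auto simp: chamber_def flag_def sel(1) subset_iff)
    moreover have "card (f ` C) = card (types \<Delta>)"
      using C(1) CX f h by (simp add: chamber_def sel card_image inj_on_subset)
    ultimately show "\<exists>C. chamber \<Delta> C \<and> F \<subseteq> C"
      using C(2) E(2) by (auto simp: chamber_def)
  qed
  ultimately show thesis using that fin by (metis finite_imageI sel(1))
qed


section \<open>The level geometry of a numbered group with a normal subgroup\<close>

datatype 'g level_type = Points | Level nat "'g set"

text \<open>\<open>Iso\<close> is incident only to universal elements. It shares its type with the points, so
  that every correlation preserves this type.\<close>

datatype 'g level_elem = Pt 'g | Lev nat 'g | Iso | Univ "'g level_type"

locale level_geometry = normal H G for H and G (structure) +
  fixes c :: "'a \<Rightarrow> nat" and n :: nat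
  assumes c: "bij_betw c (carrier G) {..<n}"
begin

lemma c_less: "g \<in> carrier G \<Longrightarrow> c g < n"
  using c by (auto simp: bij_betw_def)

lemma n_pos: "0 < n"
  using c_less[OF one_closed] by simp

lemma finite_carrier: "finite (carrier G)"
  using c bij_betw_finite by blast

fun ty :: "'a level_elem \<Rightarrow> 'a level_type" where
  "ty (Pt g) = Points"
| "ty (Lev j g) = Level j (g <# H)"
| "ty Iso = Points"
| "ty (Univ t) = t"

text \<open>A relation that is blind to types, so \<open>Univ t\<close> is even adjacent to itself.
  The relation \<open>inc\<close> keeps only the pairs of different types, which makes it
  irreflexive.\<close>

fun adj :: "'a level_elem \<Rightarrow> 'a level_elem \<Rightarrow> bool" where
  "adj (Univ _) _ = True"
| "adj _ (Univ _) = True"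
| "adj (Pt h) (Lev j g) = (c (inv g \<otimes> h) < j)"
| "adj (Lev j g) (Pt h) = (c (inv g \<otimes> h) < j)"
| "adj (Lev i g) (Lev j h) = (i \<noteq> j \<and> g = h)"
| "adj _ _ = False"

definition Ty :: "'a level_type set" where
  "Ty = insert Points {Level j (g <# H) | j g. j \<le> n \<and> g \<in> carrier G}"

text \<open>Both extreme levels matter: \<open>Lev 0 g\<close> is incident to no point and
  \<open>Lev n g\<close> to all of them.\<close>

definition X :: "'a level_elem set" where
  "X = insert Iso (Pt ` carrier G \<union> {Lev j g | j g. j \<le> n \<and> g \<in> carrier G} \<union> Univ ` Ty)"

definition \<Gamma> :: "('a level_elem, 'a level_type) incidence_structure" where
  "\<Gamma> = \<lparr>elements = X, types = Ty, typ_of = ty,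
    inc = {(x, y). x \<in> X \<and> y \<in> X \<and> ty x \<noteq> ty y \<and> adj x y}\<rparr>"

lemma \<Gamma>_simps [simp]:
  "elements \<Gamma> = X" "types \<Gamma> = Ty" "typ_of \<Gamma> = ty"
  "(x, y) \<in> inc \<Gamma> \<longleftrightarrow> x \<in> X \<and> y \<in> X \<and> ty x \<noteq> ty y \<and> adj x y"
  by (simp_all add: \<Gamma>_def)

lemma X_simps [simp]:
  "Pt g \<in> X \<longleftrightarrow> g \<in> carrier G"
  "Lev j g \<in> X \<longleftrightarrow> j \<le> n \<and> g \<in> carrier G"
  "Iso \<in> X"
  "Univ t \<in> X \<longleftrightarrow> t \<in> Ty"
  by (auto simp: X_def)

lemma ty_in_Ty: "x \<in> X \<Longrightarrow> ty x \<in> Ty"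
  by (auto simp: X_def Ty_def)

text \<open>Makes the action of a correlation on universal elements readable from its action on the
  others.\<close>

lemma Ty_cases:
  assumes "t \<in> Ty"
  obtains x where "x \<in> X" "x \<notin> range Univ" "ty x = t"
  using assms that[of Iso] that[of "Lev _ _"] by (fastforce simp: Ty_def)

lemma adj_Univ_right [simp]: "adj x (Univ t)"
  by (cases x) auto

lemma adj_sym: "adj x y \<longleftrightarrow> adj y x"
  by (cases x; cases y) auto

lemma finite_Ty: "finite Ty"
proof -
  have "{Level j (g <# H) | j g. j \<le> n \<and> g \<in> carrier G}
      = (\<lambda>(j, g). Level j (g <# H)) ` ({..n} \<times> carrier G)" by auto
  then show ?thesis by (simp add: Ty_def finite_carrier)
qed

lemma finite_X: "finite X"
proof -
  have "{Lev j g | j g. j \<le> n \<and> g \<in> carrier G} = (\<lambda>(j, g). Lev j g) ` ({..n} \<times> carrier G)"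
    by auto
  then show ?thesis by (simp add: X_def finite_carrier finite_Ty)
qed

lemma incidence_geometry_\<Gamma>: "incidence_geometry \<Gamma>"
proof
  show "elements \<Gamma> \<noteq> {}" using X_simps(3) by (metis \<Gamma>_simps(1) empty_iff)
  show "finite (types \<Gamma>)" by (simp add: finite_Ty)
  show "typ_of \<Gamma> ` elements \<Gamma> = types \<Gamma>"
    using ty_in_Ty by (auto elim!: Ty_cases)
  show "inc \<Gamma> \<subseteq> elements \<Gamma> \<times> elements \<Gamma>" by (auto simp: \<Gamma>_def)
  show "sym (inc \<Gamma>)" using adj_sym by (auto simp: sym_def)
  show "irrefl (inc \<Gamma>)" by (simp add: irrefl_def)
  show "typ_of \<Gamma> x \<noteq> typ_of \<Gamma> y" if "(x, y) \<in> inc \<Gamma>" for x y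
    using that by simp
next
  fix F assume F: "flag \<Gamma> F"
  define C where "C = F \<union> Univ ` (Ty - ty ` F)"
  have FX: "F \<subseteq> X" using F by (simp add: flag_def)
  have FF: "ty x \<noteq> ty y" "adj x y" if "x \<in> F" "y \<in> F" "x \<noteq> y" for x y
    using F that by (auto simp: flag_def)
  \<comment> \<open>Used twice: distinct elements of \<open>C\<close> have different types, as
    incidence requires, and \<open>C\<close> has as many elements as there are types.\<close>
  have inj: "inj_on ty C"
    using FF by (auto simp: inj_on_def C_def)
  have "flag \<Gamma> C"
    unfolding flag_def
  proof (intro conjI ballI impI)
    show CX: "C \<subseteq> elements \<Gamma>" using FX by (auto simp: C_def)
    fix x y assume xy: "x \<in> C" "y \<in> C" "x \<noteq> y"
    moreover have "adj x y" using xy FF(2) adj_sym by (auto simp: C_def)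
    ultimately show "(x, y) \<in> inc \<Gamma>" using CX inj by (auto simp: inj_on_def)
  qed
  moreover have "ty ` C = Ty" using FX ty_in_Ty by (auto simp: C_def image_Un image_image)
  then have "card C = card Ty" using card_image[OF inj] by simp
  ultimately show "\<exists>C. chamber \<Gamma> C \<and> F \<subseteq> C"
    by (auto simp: chamber_def C_def)
qed

section \<open>Left translations as correlations\<close>

fun act_ty :: "'a \<Rightarrow> 'a level_type \<Rightarrow> 'a level_type" where
  "act_ty k Points = Points"
| "act_ty k (Level j C) = Level j (k <# C)"

fun act :: "'a \<Rightarrow> 'a level_elem \<Rightarrow> 'a level_elem" where
  "act k (Pt g) = Pt (k \<otimes> g)"
| "act k (Lev j g) = Lev j (k \<otimes> g)"
| "act k Iso = Iso"
| "act k (Univ t) = Univ (act_ty k t)"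

lemma act_ty_closed: "k \<in> carrier G \<Longrightarrow> t \<in> Ty \<Longrightarrow> act_ty k t \<in> Ty"
  by (auto simp: Ty_def lcos_m_assoc subset intro!: exI[of _ "k \<otimes> _"])

lemma act_closed: "k \<in> carrier G \<Longrightarrow> x \<in> X \<Longrightarrow> act k x \<in> X"
  by (cases x) (auto simp: act_ty_closed)

lemma act_ty_mult:
  "k \<in> carrier G \<Longrightarrow> l \<in> carrier G \<Longrightarrow> t \<in> Ty \<Longrightarrow> act_ty (k \<otimes> l) t = act_ty k (act_ty l t)"
  by (auto simp: Ty_def lcos_m_assoc subset m_assoc)

lemma act_mult:
  "k \<in> carrier G \<Longrightarrow> l \<in> carrier G \<Longrightarrow> x \<in> X \<Longrightarrow> act (k \<otimes> l) x = act k (act l x)"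
  by (cases x) (auto simp: act_ty_mult m_assoc)

lemma act_ty_one: "t \<in> Ty \<Longrightarrow> act_ty \<one> t = t"
  by (auto simp: Ty_def lcos_m_assoc subset)

lemma act_one: "x \<in> X \<Longrightarrow> act \<one> x = x"
  by (cases x) (auto simp: act_ty_one)

lemma ty_act: "k \<in> carrier G \<Longrightarrow> x \<in> X \<Longrightarrow> ty (act k x) = act_ty k (ty x)"
  by (cases x) (auto simp: lcos_m_assoc subset)

lemma act_inv:
  "k \<in> carrier G \<Longrightarrow> x \<in> X \<Longrightarrow> act (inv k) (act k x) = x"
  "k \<in> carrier G \<Longrightarrow> x \<in> X \<Longrightarrow> act k (act (inv k) x) = x"
  using act_mult[of "inv k" k x] act_mult[of k "inv k" x] act_one by auto

lemma act_ty_eq_iff: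
  assumes "k \<in> carrier G" "s \<in> Ty" "t \<in> Ty"
  shows "act_ty k s = act_ty k t \<longleftrightarrow> s = t"
  using assms act_ty_mult[of "inv k" k] act_ty_one by (metis inv_closed l_inv)

text \<open>On points and level elements, \<open>adj\<close> sees the group only through the
  quotients \<open>inv g \<otimes> h\<close> and through equality of group elements; left
  translation changes neither.\<close>

lemma adj_act:
  assumes k: "k \<in> carrier G" and "x \<in> X" "y \<in> X"
  shows "adj (act k x) (act k y) \<longleftrightarrow> adj x y"
proof -
  have "inv (k \<otimes> g) \<otimes> (k \<otimes> h) = inv g \<otimes> h" if "g \<in> carrier G" "h \<in> carrier G" for g h
  proof -
    have "inv (k \<otimes> g) \<otimes> (k \<otimes> h) = inv g \<otimes> (inv k \<otimes> (k \<otimes> h))"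
      using that k by (simp add: inv_mult_group m_assoc)
    also have "inv k \<otimes> (k \<otimes> h) = h"
      using that k by (simp flip: m_assoc)
    finally show ?thesis .
  qed
  then show ?thesis using assms by (cases x; cases y) auto
qed

lemma act_correlation:
  assumes k: "k \<in> carrier G"
  shows "restrict (act k) X \<in> correlations \<Gamma>"
proof -
  have "bij_betw (act k) X X"
    by (rule bij_betw_byWitness[where f' = "act (inv k)"]) (use k act_inv act_closed in auto)
  then have "restrict (act k) X \<in> Bij X"
    by (simp add: Bij_def)
  then show ?thesis
    using k by (auto simp: correlations_def act_closed ty_act act_ty_eq_iff ty_in_Ty adj_act)
qed

text \<open>The type of \<open>Lev 0 \<one>\<close> carries the coset \<open>H\<close> itself, and
  fixing it forces \<open>k \<in> H\<close>. Conversely, normality rewrites \<open>g <# H\<close> as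
  \<open>H #> g\<close>, so that \<open>H\<close> absorbs \<open>k\<close> from the left.\<close>

lemma act_fixes_types_iff:
  assumes k: "k \<in> carrier G"
  shows "(\<forall>x\<in>X. ty (act k x) = ty x) \<longleftrightarrow> k \<in> H"
proof
  assume *: "\<forall>x\<in>X. ty (act k x) = ty x"
  have "ty (act k (Lev 0 \<one>)) = ty (Lev 0 \<one>)" using * by (metis X_simps(2) le0 one_closed)
  then have "k <# H = H" using k by (simp add: lcos_mult_one subset)
  moreover have "k \<in> k <# H" using k subgroup.one_closed[OF subgroup_axioms]
    by (force simp: l_coset_def)
  ultimately show "k \<in> H" by simp
next
  assume kH: "k \<in> H"
  have "k <# (g <# H) = g <# H" if g: "g \<in> carrier G" for g
  proof -
    have "k <# (H #> g) = (k <# H) #> g" using k g by (simp add: coset_assoc subset)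
    also have "k <# H = H" using k kH coset_join3 subgroup_axioms by blast
    finally show ?thesis using coset_eq g by simp
  qed
  then have "act_ty k t = t" if "t \<in> Ty" for t using that by (auto simp: Ty_def)
  then show "\<forall>x\<in>X. ty (act k x) = ty x" using k by (simp add: ty_act ty_in_Ty)
qed

section \<open>Recognising the kinds of elements from incidence and equality of types\<close>

lemma Univ_iff:
  assumes "x \<in> X"
  shows "x \<in> range Univ \<longleftrightarrow> (\<forall>y\<in>X. ty y \<noteq> ty x \<longrightarrow> (x, y) \<in> inc \<Gamma>)"
proof
  assume *: "\<forall>y\<in>X. ty y \<noteq> ty x \<longrightarrow> (x, y) \<in> inc \<Gamma>"
  show "x \<in> range Univ"
    \<comment> \<open>Non-universal witnesses of failure: \<open>Lev 0 \<one>\<close> is incident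
      neither to points nor to \<open>Iso\<close>, and \<open>Iso\<close> is incident to no level
      element.\<close>
    using assms bspec[OF *, of "Lev 0 \<one>"] bspec[OF *, of Iso] by (cases x) auto
qed (use assms in auto)

lemma Iso_iff:
  assumes x: "x \<in> X"
  shows "x = Iso \<longleftrightarrow> x \<notin> range Univ \<and> (\<forall>y\<in>X. (x, y) \<in> inc \<Gamma> \<longrightarrow> y \<in> range Univ)"
proof
  assume "x = Iso"
  moreover have "y \<in> range Univ" if "adj Iso y" for y using that by (cases y) auto
  ultimately show "x \<notin> range Univ \<and> (\<forall>y\<in>X. (x, y) \<in> inc \<Gamma> \<longrightarrow> y \<in> range Univ)" by auto
next
  assume "x \<notin> range Univ \<and> (\<forall>y\<in>X. (x, y) \<in> inc \<Gamma> \<longrightarrow> y \<in> range Univ)"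
  then have *: "x \<notin> range Univ" "\<And>y. (x, y) \<in> inc \<Gamma> \<Longrightarrow> y \<in> range Univ" by auto
  show "x = Iso"
  proof (cases x)
    case (Pt h)
    \<comment> \<open>The top level is incident to every point; here the number to be compared with
      \<open>n\<close> is \<open>c \<one>\<close>.\<close>
    then show ?thesis using *(2)[of "Lev n h"] x c_less[OF one_closed] by auto
  next
    case (Lev j g)
    \<comment> \<open>Since \<open>0 < n\<close>, at least one of the levels 0 and \<open>n\<close>
      differs from \<open>j\<close> and gives a non-universal neighbour over the same
      \<open>g\<close>.\<close>
    then show ?thesis
      using *(2)[of "Lev n g"] *(2)[of "Lev 0 g"] x n_pos by (cases "j = 0") auto
  qed (use * in auto)
qed

text \<open>Once universal elements and \<open>Iso\<close> are recognised, the points are what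
  remains of the type of \<open>Iso\<close>.\<close>

lemma Pt_iff:
  "x \<in> X \<Longrightarrow> x \<in> Pt ` carrier G \<longleftrightarrow> ty x = ty Iso \<and> x \<notin> range Univ \<and> x \<noteq> Iso"
  by (cases x) auto

text \<open>The map sending \<open>h\<close> to \<open>c (inv g \<otimes> h)\<close> is a bijection
  from the group onto \<open>{..<n}\<close>. As \<open>j \<le> n\<close>, all of
  \<open>{..<j}\<close> is attained; the preimage of \<open>c s\<close> is
  \<open>g \<otimes> s\<close>.\<close>

lemma card_Pt_incident:
  assumes "j \<le> n" "g \<in> carrier G"
  shows "card {y \<in> Pt ` carrier G. (Lev j g, y) \<in> inc \<Gamma>} = j"
proof -
  let ?A = "{h \<in> carrier G. c (inv g \<otimes> h) < j}"
  have "{y \<in> Pt ` carrier G. (Lev j g, y) \<in> inc \<Gamma>} = Pt ` ?A"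
    using assms by auto
  then have "card {y \<in> Pt ` carrier G. (Lev j g, y) \<in> inc \<Gamma>} = card ?A"
    by (simp add: card_image inj_on_def)
  also have "inj_on (\<lambda>h. c (inv g \<otimes> h)) ?A"
  proof (rule inj_onI)
    fix x y assume "x \<in> ?A" "y \<in> ?A" "c (inv g \<otimes> x) = c (inv g \<otimes> y)"
    moreover from this have "inv g \<otimes> x = inv g \<otimes> y"
      using assms c by (auto simp: bij_betw_def dest: inj_onD)
    ultimately show "x = y" using assms by simp
  qed
  then have "card ?A = card ((\<lambda>h. c (inv g \<otimes> h)) ` ?A)"
    by (simp add: card_image)
  also have "(\<lambda>h. c (inv g \<otimes> h)) ` ?A = {..<j}"
  proof
    show "{..<j} \<subseteq> (\<lambda>h. c (inv g \<otimes> h)) ` ?A"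
    proof
      fix i assume i: "i \<in> {..<j}"
      then have "i \<in> c ` carrier G" using assms(1) c by (auto simp: bij_betw_def)
      then obtain s where s: "s \<in> carrier G" "i = c s" by blast
      have "inv g \<otimes> (g \<otimes> s) = s" using s assms by (simp flip: m_assoc)
      then show "i \<in> (\<lambda>h. c (inv g \<otimes> h)) ` ?A"
        using s i assms by (intro image_eqI[of _ _ "g \<otimes> s"]) auto
    qed
  qed auto
  finally show ?thesis by simp
qed

section \<open>Every correlation is a left translation\<close>

context
  fixes \<phi> assumes \<phi>: "\<phi> \<in> correlations \<Gamma>"
begin

lemma \<phi>_image: "\<phi> ` X = X" and \<phi>_inj: "inj_on \<phi> X"
  using \<phi> by (auto simp: correlations_def Bij_def bij_betw_def)

lemma \<phi>_closed: "x \<in> X \<Longrightarrow> \<phi> x \<in> X"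
  using \<phi>_image by blast

lemma \<phi>_inc: "x \<in> X \<Longrightarrow> y \<in> X \<Longrightarrow> (\<phi> x, \<phi> y) \<in> inc \<Gamma> \<longleftrightarrow> (x, y) \<in> inc \<Gamma>"
  using \<phi> unfolding correlations_def \<Gamma>_simps(1) by blast

lemma \<phi>_ty: "x \<in> X \<Longrightarrow> y \<in> X \<Longrightarrow> ty (\<phi> x) = ty (\<phi> y) \<longleftrightarrow> ty x = ty y"
  using \<phi> by (simp add: correlations_def)

text \<open>Reindexing by \<open>\<phi>\<close> turns the incidence characterisation of
  \<open>\<phi> x\<close> into that of \<open>x\<close>; this is how the invariance of universal
  elements and of \<open>Iso\<close> is obtained.\<close>

lemma \<phi>_Ball: "(\<forall>y\<in>X. P y) \<longleftrightarrow> (\<forall>y\<in>X. P (\<phi> y))"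
  using \<phi>_image by (metis image_iff)

lemma \<phi>_Univ_iff: "x \<in> X \<Longrightarrow> \<phi> x \<in> range Univ \<longleftrightarrow> x \<in> range Univ"
  by (simp only: Univ_iff \<phi>_closed \<phi>_Ball[of "\<lambda>y. ty y \<noteq> ty (\<phi> x) \<longrightarrow> (\<phi> x, y) \<in> inc \<Gamma>"]
      \<phi>_inc \<phi>_ty cong: ball_cong)

lemma \<phi>_Iso_iff: "x \<in> X \<Longrightarrow> \<phi> x = Iso \<longleftrightarrow> x = Iso"
  by (simp only: Iso_iff \<phi>_closed \<phi>_Ball[of "\<lambda>y. (\<phi> x, y) \<in> inc \<Gamma> \<longrightarrow> y \<in> range Univ"]
      \<phi>_inc \<phi>_Univ_iff cong: ball_cong)

text \<open>Because \<open>\<phi>\<close> fixes \<open>Iso\<close>, it also preserves the class of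
  elements that share its type.\<close>

lemma \<phi>_ty_Iso_iff: "x \<in> X \<Longrightarrow> ty (\<phi> x) = ty Iso \<longleftrightarrow> ty x = ty Iso"
  using \<phi>_ty[of x Iso] \<phi>_Iso_iff[of Iso] X_simps(3) by metis

lemma \<phi>_Pt_iff: "x \<in> X \<Longrightarrow> \<phi> x \<in> Pt ` carrier G \<longleftrightarrow> x \<in> Pt ` carrier G"
  by (simp only: Pt_iff \<phi>_closed \<phi>_Univ_iff \<phi>_Iso_iff \<phi>_ty_Iso_iff)

text \<open>By exclusion the image lies on some level. The points incident to \<open>Lev j g\<close>
  are mapped bijectively onto those incident to the image, and their number determines the
  level.\<close>

lemma \<phi>_Lev:
  assumes "j \<le> n" "g \<in> carrier G"
  shows "\<exists>g'\<in>carrier G. \<phi> (Lev j g) = Lev j g'"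
proof -
  let ?x = "Lev j g"
  have x: "?x \<in> X" using assms by simp
  have "\<phi> ?x \<notin> range Univ" "\<phi> ?x \<noteq> Iso" "\<phi> ?x \<notin> Pt ` carrier G"
    using \<phi>_Univ_iff[OF x] \<phi>_Iso_iff[OF x] \<phi>_Pt_iff[OF x] by auto
  then obtain j' g' where eq: "\<phi> ?x = Lev j' g'" and *: "j' \<le> n" "g' \<in> carrier G"
    using \<phi>_closed[OF x] by (cases "\<phi> ?x") auto
  have "{y \<in> Pt ` carrier G. (\<phi> ?x, y) \<in> inc \<Gamma>} = \<phi> ` {y \<in> Pt ` carrier G. (?x, y) \<in> inc \<Gamma>}"
    (is "?N' = \<phi> ` ?N")
  proof
    show "\<phi> ` ?N \<subseteq> ?N'"
    proof clarify
      fix h assume h: "h \<in> carrier G" "(?x, Pt h) \<in> inc \<Gamma>"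
      then have "Pt h \<in> X" by simp
      from \<phi>_Pt_iff[OF this] \<phi>_inc[OF x this] h
      show "\<phi> (Pt h) \<in> Pt ` carrier G \<and> (\<phi> ?x, \<phi> (Pt h)) \<in> inc \<Gamma>" by blast
    qed
    show "?N' \<subseteq> \<phi> ` ?N"
    proof
      fix y assume y: "y \<in> ?N'"
      then have "y \<in> X" by auto
      then obtain z where z: "z \<in> X" "y = \<phi> z" using \<phi>_image by blast
      then show "y \<in> \<phi> ` ?N" using y \<phi>_Pt_iff[OF z(1)] \<phi>_inc[OF x z(1)] by blast
    qed
  qed
  moreover have "inj_on \<phi> ?N" by (rule inj_on_subset[OF \<phi>_inj]) auto
  ultimately have "card ?N' = card ?N" by (simp add: card_image)
  moreover have "card ?N = j" by (rule card_Pt_incident[OF assms])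
  moreover have "card ?N' = j'" unfolding eq by (rule card_Pt_incident[OF *])
  ultimately have "j' = j" by simp
  with eq * show ?thesis by blast
qed

lemma \<phi>_eq_act: "\<exists>k\<in>carrier G. \<forall>x\<in>X. \<phi> x = act k x"
proof -
  have "\<forall>h\<in>carrier G. \<exists>h'\<in>carrier G. \<phi> (Pt h) = Pt h'"
    using \<phi>_Pt_iff by (metis X_simps(1) image_iff)
  then obtain a where a: "\<And>h. h \<in> carrier G \<Longrightarrow> a h \<in> carrier G \<and> \<phi> (Pt h) = Pt (a h)"
    by metis
  obtain b where b: "\<And>j g. j \<le> n \<Longrightarrow> g \<in> carrier G \<Longrightarrow>
      b j g \<in> carrier G \<and> \<phi> (Lev j g) = Lev j (b j g)"
    using \<phi>_Lev by metis
  \<comment> \<open>For \<open>j > 0\<close>, incidence between \<open>Lev j g\<close> and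
    \<open>Lev 0 g\<close> is preserved, and between different levels it forces equal group
    elements.\<close>
  have b0: "b j g = b 0 g" if "j \<le> n" "g \<in> carrier G" for j g
    using \<phi>_inc[of "Lev j g" "Lev 0 g"] b[of j g] b[of 0 g] that by (cases "j = 0") auto
  have quot: "inv (b 0 g) \<otimes> a h = inv g \<otimes> h" if g: "g \<in> carrier G" and h: "h \<in> carrier G" for g h
  proof -
    have *: "inv (b 0 g) \<otimes> a h \<in> carrier G" "inv g \<otimes> h \<in> carrier G"
      using g h a b by auto
    \<comment> \<open>Each level is a threshold test on the number of the quotient.\<close>
    have iff: "c (inv (b 0 g) \<otimes> a h) < j \<longleftrightarrow> c (inv g \<otimes> h) < j" if j: "j \<le> n" for j
      using \<phi>_inc[of "Lev j g" "Pt h"] a[OF h] b[OF j g] b0[OF j g] g h j by simp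
    have "c (inv (b 0 g) \<otimes> a h) = c (inv g \<otimes> h)"
      \<comment> \<open>Both numbers are below \<open>n\<close>, so each is itself an admissible
        threshold. A number is not below itself, so neither number is below the other.\<close>
      using iff[of "c (inv g \<otimes> h)"] iff[of "c (inv (b 0 g) \<otimes> a h)"] *[THEN c_less] by simp
    then show ?thesis using * c by (auto simp: bij_betw_def inj_on_def)
  qed
  \<comment> \<open>The translation factor is read off at the identity: \<open>quot\<close> at
    \<open>\<one>\<close> determines \<open>a\<close>, and then \<open>quot\<close> at the pair
    \<open>g\<close>, \<open>g\<close> determines \<open>b 0\<close>.\<close>
  define k where "k = b 0 \<one>"
  have k: "k \<in> carrier G" using b[of 0 \<one>] by (simp add: k_def)
  have a_eq: "a h = k \<otimes> h" if "h \<in> carrier G" for h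
    using quot[OF one_closed that] a[OF that] k that
    by (simp add: k_def inv_solve_left')
  have b_eq: "b 0 g = k \<otimes> g" if g: "g \<in> carrier G" for g
  proof -
    have "inv (b 0 g) \<otimes> (k \<otimes> g) = \<one>" using quot[OF g g] a_eq[OF g] g by simp
    then show ?thesis using b[of 0 g] k g by (simp add: inv_solve_left')
  qed
  have nonuniv: "\<phi> x = act k x" if "x \<in> X" "x \<notin> range Univ" for x
  proof (cases x)
    case (Lev j g)
    then show ?thesis using that b[of j g] b0[of j g] b_eq[of g] by simp
  qed (use that a a_eq \<phi>_Iso_iff[of Iso] in auto)
  \<comment> \<open>The image is again universal, so its type determines it. That type is found from
    a non-universal element of type \<open>t\<close>.\<close>
  have "\<phi> (Univ t) = act k (Univ t)" if t: "t \<in> Ty" for t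
  proof -
    have U: "Univ t \<in> X" using t by simp
    obtain x where x: "x \<in> X" "x \<notin> range Univ" "ty x = t" using t by (rule Ty_cases)
    have "ty (\<phi> (Univ t)) = ty (\<phi> x)" using \<phi>_ty[OF U x(1)] x(3) by simp
    also have "\<dots> = act_ty k t" using nonuniv x ty_act[OF k x(1)] by simp
    finally show ?thesis using \<phi>_Univ_iff[OF U] by auto
  qed
  then show ?thesis using nonuniv k by (metis X_simps(4) imageE)
qed

end

text \<open>Surjectivity comes from \<open>\<phi>_eq_act\<close>. For injectivity, \<open>k\<close>
  is recovered from the image of \<open>Pt \<one>\<close>.\<close>

lemma act_iso:
  shows "(\<lambda>k. restrict (act k) X) \<in> iso G (Aut \<Gamma>)"
    and "(\<lambda>k. restrict (act k) X) ` H = automorphisms \<Gamma>"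
proof -
  let ?\<rho> = "\<lambda>k. restrict (act k) X"
  have carr: "carrier (Aut \<Gamma>) = correlations \<Gamma>" by (simp add: Aut_def)
  have "?\<rho> \<in> hom G (Aut \<Gamma>)"
    using act_correlation
    by (auto simp: hom_def carr mult_Aut compose_def act_mult act_closed intro!: restrict_ext)
  moreover have onto: "\<exists>k\<in>carrier G. \<phi> = ?\<rho> k" if "\<phi> \<in> correlations \<Gamma>" for \<phi>
    using \<phi>_eq_act[OF that] correlations_eqI[OF that act_correlation] by auto
  moreover have "inj_on ?\<rho> (carrier G)"
  proof (rule inj_onI)
    fix k l assume kl: "k \<in> carrier G" "l \<in> carrier G" and eq: "?\<rho> k = ?\<rho> l"
    from eq have "?\<rho> k (Pt \<one>) = ?\<rho> l (Pt \<one>)" by (rule fun_cong)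
    then show "k = l" using kl by simp
  qed
  ultimately show "?\<rho> \<in> iso G (Aut \<Gamma>)"
    using act_correlation by (auto simp: iso_iff carr)
  have "?\<rho> k \<in> automorphisms \<Gamma> \<longleftrightarrow> k \<in> H" if "k \<in> carrier G" for k
    using act_correlation[OF that] act_fixes_types_iff[OF that] by (simp add: automorphisms_def)
  moreover have "automorphisms \<Gamma> \<subseteq> correlations \<Gamma>" by (auto simp: automorphisms_def)
  ultimately show "?\<rho> ` H = automorphisms \<Gamma>"
    using onto subset by blast
qed

end

theorem theoremA:
  fixes G :: "('g, 'm) monoid_scheme" and H :: "'g set"
  assumes "group G" and "finite (carrier G)" and "H \<lhd> G"
  shows "\<exists>\<Gamma> :: (nat, nat) incidence_structure.
    incidence_geometry \<Gamma> \<and> finite (elements \<Gamma>) \<and>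
    (\<exists>\<phi> \<in> iso (Aut \<Gamma>) G. \<phi> ` automorphisms \<Gamma> = H)"
proof -
  obtain c where c: "bij_betw c (carrier G) {..<card (carrier G)}"
    using ex_bij_betw_finite_nat[OF assms(2)] by (auto simp: atLeast0LessThan)
  interpret N: normal H G by fact
  interpret L: level_geometry H G c "card (carrier G)"
    by unfold_locales (rule c)
  obtain \<Delta> :: "(nat, nat) incidence_structure" and f
    where \<Delta>: "incidence_geometry \<Delta>" "finite (elements \<Delta>)" and f: "incidence_equiv f L.\<Gamma> \<Delta>"
    using incidence_geometry_nat_copy[OF L.incidence_geometry_\<Gamma>] L.finite_X by auto
  let ?\<rho> = "\<lambda>k. restrict (L.act k) L.X"
  \<comment> \<open>Translation on the level geometry followed by transport to the copy over
    \<open>nat\<close>. This leads from \<open>G\<close> to \<open>Aut \<Delta>\<close>, so its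
    inverse is the isomorphism sought.\<close>
  let ?\<psi> = "conj_map f L.\<Gamma> \<Delta> \<circ> ?\<rho>"
  have \<psi>: "?\<psi> \<in> iso G (Aut \<Delta>)"
    by (rule iso_set_trans[OF L.act_iso(1) conj_map_iso(1)[OF f]])
  have im: "?\<psi> ` H = automorphisms \<Delta>"
    by (simp only: image_comp[symmetric] L.act_iso(2) conj_map_iso(2)[OF f])
  have "inj_on ?\<psi> (carrier G)" using \<psi> by (simp add: iso_iff)
  then have "inv_into (carrier G) ?\<psi> ` automorphisms \<Delta> = H"
    unfolding im[symmetric] by (rule inv_into_image_cancel) (rule N.subset)
  moreover have "inv_into (carrier G) ?\<psi> \<in> iso (Aut \<Delta>) G"
    by (rule N.iso_set_sym[OF \<psi>])
  ultimately show ?thesis using \<Delta> by blast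
qed

end
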